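(* Let $T$ be a Hausdorff topological group, $X$ a compact Hausdorff space, and $T\curvearrowright X$ any flow. Let $H$ be a closed subgroup of $T$ and let $H\curvearrowright X$ be the flow obtained by restricting the action to $H$. Then: (1) If $H\in\mathcal S^{\mathrm{sncc}}(T)$ and $x\in X$ is almost periodic for $T\curvearrowright X$, then $x$ is almost periodic for $H\curvearrowright X$. (2) If $H$ is co-compact in $T$ and $x\in X$ is almost periodic for $H\curvearrowright X$, then $x$ is almost periodic for $T\curvearrowright X$. (3) If $T\curvearrowright X$ is minimal and $H\in\mathcal S^{\mathrm{ncc}}(T)$, then $\{\overline{Hx}\mid x\in X\}$ is a $T$-invariant partition of $X$ and the map $\mathscr O_H\colon X\to 2^X$, $x\mapsto\overline{Hx}$, is continuous. Consequently, for every $H\in\mathcal S^{\mathrm{sncc}}(T)$, a point $x\in X$ is almost periodic for $T\curvearrowright X$ if and only if it is almost periodic for $H\curvearrowright X$.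
   Context: A flow $T\curvearrowright X$ is a jointly continuous map $T\times X\to X$, $(t,x)\mapsto tx$, with $ex=x$ and $(st)x=s(tx)$ for all $s,t\in T$, $x\in X$, where $e$ is the identity of $T$. The flow is minimal if $\overline{Tx}=X$ for all $x\in X$. A subset $A\subseteq T$ is syndetic in $T$ if there is a nonempty compact $K\subseteq T$ with $T=K^{-1}A$. A point $x\in X$ is almost periodic for $T\curvearrowright X$ if for every neighborhood $U$ of $x$ in $X$ the set $\{t\in T\mid tx\in U\}$ is syndetic in $T$; almost periodicity for $H\curvearrowright X$ is defined the same way with $H$ in place of $T$. A subgroup $H$ of $T$ is co-compact if the left-coset space $T/H$ with the quotient topology is compact. A subgroup $H$ is subnormal in $T$ if there is a finite sequence of subgroups $H=H_0<H_1<\cdots<H_n=T$ with $H_i$ normal in $H_{i+1}$ for $0\le i<n$. $\mathcal S^{\mathrm{ncc}}(T)$ denotes the family of normal co-compact closed subgroups of $T$, and $\mathcal S^{\mathrm{sncc}}(T)$ the family of subnormal co-compact closed subgroups of $T$. $2^X$ is the set of nonempty compact subsets of $X$ with the Vietoris topology. *)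

theory Defs
  imports "HOL-Analysis.Analysis" "HOL-Algebra.Left_Coset"
begin

section \<open>Topological groups and flows\<close>

locale topological_group = group G for G (structure) +
  fixes \<tau> :: "'a topology"
  assumes topspace_eq_carrier: "topspace \<tau> = carrier G"
    and continuous_mult: "continuous_map (prod_topology \<tau> \<tau>) \<tau> (\<lambda>(s, t). s \<otimes> t)"
    and continuous_inv: "continuous_map \<tau> \<tau> (\<lambda>t. inv t)"

locale flow = topological_group G \<tau> for G (structure) and \<tau> +
  fixes X :: "'x topology" and act :: "'a \<Rightarrow> 'x \<Rightarrow> 'x"
  assumes continuous_act: "continuous_map (prod_topology \<tau> X) X (\<lambda>(t, x). act t x)"
    and act_one: "x \<in> topspace X \<Longrightarrow> act \<one> x = x"
    and act_mult: "\<lbrakk>s \<in> carrier G; t \<in> carrier G; x \<in> topspace X\<rbrakk>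
                     \<Longrightarrow> act (s \<otimes> t) x = act s (act t x)"

text \<open>The restriction of an action to a subgroup \<open>H\<close> is given by the group
  \<open>G\<lparr>carrier := H\<rparr>\<close> with the subspace topology and the same map \<open>act\<close>.\<close>

lemma (in topological_group) topological_group_subgroup:
  assumes "subgroup H G"
  shows "topological_group (G\<lparr>carrier := H\<rparr>) (subtopology \<tau> H)"
proof -
  have sub: "H \<subseteq> carrier G"
    using assms by (rule subgroup.subset)
  interpret K: group "G\<lparr>carrier := H\<rparr>"
    using assms by (rule subgroup_imp_group)
  have top: "topspace (subtopology \<tau> H) = H"
    using sub topspace_eq_carrier by auto
  have "continuous_map (subtopology \<tau> H) (subtopology \<tau> H) (\<lambda>t. inv t)"
    using continuous_inv subgroup.m_inv_closed[OF assms] top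
    by (auto simp: continuous_map_in_subtopology continuous_map_from_subtopology)
  then have inv: "continuous_map (subtopology \<tau> H) (subtopology \<tau> H)
      (\<lambda>t. inv\<^bsub>G\<lparr>carrier := H\<rparr>\<^esub> t)"
    by (rule continuous_map_eq) (use top assms m_inv_consistent in auto)
  have "continuous_map (subtopology (prod_topology \<tau> \<tau>) (H \<times> H)) (subtopology \<tau> H)
      (\<lambda>(s, t). s \<otimes> t)"
    using continuous_mult subgroup.m_closed[OF assms]
    by (auto simp: continuous_map_in_subtopology continuous_map_from_subtopology)
  then show ?thesis
    using inv top by unfold_locales (simp_all add: subtopology_Times)
qed

lemma (in flow) flow_subgroup:
  assumes "subgroup H G"
  shows "flow (G\<lparr>carrier := H\<rparr>) (subtopology \<tau> H) X act"
proof -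
  interpret K: topological_group "G\<lparr>carrier := H\<rparr>" "subtopology \<tau> H"
    using assms by (rule topological_group_subgroup)
  have "continuous_map (subtopology (prod_topology \<tau> X) (H \<times> topspace X)) X (\<lambda>(t, x). act t x)"
    using continuous_act by (rule continuous_map_from_subtopology)
  then have "continuous_map (prod_topology (subtopology \<tau> H) X) X (\<lambda>(t, x). act t x)"
    by (simp add: subtopology_Times)
  then show ?thesis
    using act_one act_mult subgroup.subset[OF assms] by unfold_locales (auto simp: subset_iff)
qed

definition orbit_closure ::
    "('a, 'm) monoid_scheme \<Rightarrow> 'x topology \<Rightarrow> ('a \<Rightarrow> 'x \<Rightarrow> 'x) \<Rightarrow> 'x \<Rightarrow> 'x set" where
  "orbit_closure G X act x = X closure_of ((\<lambda>t. act t x) ` carrier G)"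

definition minimal_flow ::
    "('a, 'm) monoid_scheme \<Rightarrow> 'x topology \<Rightarrow> ('a \<Rightarrow> 'x \<Rightarrow> 'x) \<Rightarrow> bool" where
  "minimal_flow G X act \<longleftrightarrow> (\<forall>x \<in> topspace X. orbit_closure G X act x = topspace X)"

definition syndetic :: "('a, 'm) monoid_scheme \<Rightarrow> 'a topology \<Rightarrow> 'a set \<Rightarrow> bool" where
  "syndetic G \<tau> A \<longleftrightarrow> A \<subseteq> carrier G \<and>
     (\<exists>K. K \<noteq> {} \<and> compactin \<tau> K \<and> carrier G = (set_inv\<^bsub>G\<^esub> K) <#>\<^bsub>G\<^esub> A)"

text \<open>Neighbourhoods need not be open: \<open>U\<close> is a neighbourhood of \<open>x\<close> if
  \<open>x\<close> lies in the interior of \<open>U\<close>.\<close>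

definition almost_periodic ::
    "('a, 'm) monoid_scheme \<Rightarrow> 'a topology \<Rightarrow> 'x topology \<Rightarrow> ('a \<Rightarrow> 'x \<Rightarrow> 'x) \<Rightarrow> 'x \<Rightarrow> bool" where
  "almost_periodic G \<tau> X act x \<longleftrightarrow>
     (\<forall>U. U \<subseteq> topspace X \<and> x \<in> X interior_of U \<longrightarrow> syndetic G \<tau> {t \<in> carrier G. act t x \<in> U})"


section \<open>Co-compact and subnormal subgroups\<close>

definition quotient_topology :: "'a topology \<Rightarrow> ('a \<Rightarrow> 'b) \<Rightarrow> 'b topology" where
  "quotient_topology X f =
     topology (\<lambda>U. U \<subseteq> f ` topspace X \<and> openin X {x \<in> topspace X. f x \<in> U})"

lemma openin_quotient_topology:
  "openin (quotient_topology X f) U \<longleftrightarrow>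
     U \<subseteq> f ` topspace X \<and> openin X {x \<in> topspace X. f x \<in> U}"
proof -
  have "istopology (\<lambda>U. U \<subseteq> f ` topspace X \<and> openin X {x \<in> topspace X. f x \<in> U})"
    unfolding istopology_def
  proof (intro conjI allI impI)
    fix S T
    assume "S \<subseteq> f ` topspace X \<and> openin X {x \<in> topspace X. f x \<in> S}"
      and "T \<subseteq> f ` topspace X \<and> openin X {x \<in> topspace X. f x \<in> T}"
    moreover have "{x \<in> topspace X. f x \<in> S \<inter> T} =
        {x \<in> topspace X. f x \<in> S} \<inter> {x \<in> topspace X. f x \<in> T}" by auto
    ultimately show "S \<inter> T \<subseteq> f ` topspace X" "openin X {x \<in> topspace X. f x \<in> S \<inter> T}"
      by (auto simp del: Int_iff)
  next
    fix \<K>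
    assume *: "\<forall>K\<in>\<K>. K \<subseteq> f ` topspace X \<and> openin X {x \<in> topspace X. f x \<in> K}"
    then show "\<Union>\<K> \<subseteq> f ` topspace X" by blast
    have "{x \<in> topspace X. f x \<in> \<Union>\<K>} = (\<Union>K\<in>\<K>. {x \<in> topspace X. f x \<in> K})" by auto
    then show "openin X {x \<in> topspace X. f x \<in> \<Union>\<K>}"
      using * by (simp only:) (rule openin_Union, auto)
  qed
  then show ?thesis
    by (simp add: quotient_topology_def topology_inverse')
qed

lemma topspace_quotient_topology [simp]:
  "topspace (quotient_topology X f) = f ` topspace X"
proof
  show "topspace (quotient_topology X f) \<subseteq> f ` topspace X"
    by (metis openin_quotient_topology openin_topspace)
  have "{x \<in> topspace X. f x \<in> f ` topspace X} = topspace X" by auto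
  then have "openin (quotient_topology X f) (f ` topspace X)"
    by (simp add: openin_quotient_topology)
  then show "f ` topspace X \<subseteq> topspace (quotient_topology X f)"
    by (rule openin_subset)
qed

lemma quotient_map_quotient_topology: "quotient_map X (quotient_topology X f) f"
  by (simp add: quotient_map_def openin_quotient_topology)

definition left_coset_space ::
    "('a, 'm) monoid_scheme \<Rightarrow> 'a topology \<Rightarrow> 'a set \<Rightarrow> 'a set topology" where
  "left_coset_space G \<tau> H = quotient_topology \<tau> (\<lambda>t. t <#\<^bsub>G\<^esub> H)"

lemma (in topological_group) topspace_left_coset_space:
  "topspace (left_coset_space G \<tau> H) = lcosets H"
  by (auto simp: left_coset_space_def LCOSETS_def topspace_eq_carrier)

definition cocompact :: "('a, 'm) monoid_scheme \<Rightarrow> 'a topology \<Rightarrow> 'a set \<Rightarrow> bool" where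
  "cocompact G \<tau> H \<longleftrightarrow> compact_space (left_coset_space G \<tau> H)"

text \<open>The intermediate groups of the chain are not required to be closed. Allowing
  repetitions in the chain makes no difference.\<close>

definition subnormal :: "'a set \<Rightarrow> ('a, 'm) monoid_scheme \<Rightarrow> bool" where
  "subnormal H G \<longleftrightarrow>
     (\<exists>(n::nat) K. K 0 = H \<and> K n = carrier G \<and> (\<forall>i\<le>n. subgroup (K i) G) \<and>
        (\<forall>i<n. K i \<lhd> G\<lparr>carrier := K (Suc i)\<rparr>))"

definition ncc_subgroups :: "('a, 'm) monoid_scheme \<Rightarrow> 'a topology \<Rightarrow> 'a set set" where
  "ncc_subgroups G \<tau> = {H. H \<lhd> G \<and> cocompact G \<tau> H \<and> closedin \<tau> H}"

definition sncc_subgroups :: "('a, 'm) monoid_scheme \<Rightarrow> 'a topology \<Rightarrow> 'a set set" where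
  "sncc_subgroups G \<tau> = {H. subgroup H G \<and> subnormal H G \<and> cocompact G \<tau> H \<and> closedin \<tau> H}"


section \<open>The hyperspace of nonempty compact subsets\<close>

definition vietoris :: "'x topology \<Rightarrow> 'x set topology" where
  "vietoris X = topology_generated_by
     ((\<lambda>U. {K. compactin X K \<and> K \<noteq> {} \<and> K \<subseteq> U}) ` {U. openin X U} \<union>
      (\<lambda>U. {K. compactin X K \<and> K \<noteq> {} \<and> K \<inter> U \<noteq> {}}) ` {U. openin X U})"

lemma topspace_vietoris: "topspace (vietoris X) = {K. compactin X K \<and> K \<noteq> {}}"
proof -
  have "{K. compactin X K \<and> K \<noteq> {}} = {K. compactin X K \<and> K \<noteq> {} \<and> K \<subseteq> topspace X}"
    using compactin_subset_topspace by blast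
  then show ?thesis
    unfolding vietoris_def topology_generated_by_topspace by blast
qed

end

theory Submission
  imports Defs
begin

text \<open>In a compact Hausdorff space, a point is almost periodic iff its orbit closure is minimal. The
  key fact is that if \<open>H\<close> is co-compact and \<open>M\<close> is closed and \<open>H\<close>-invariant, then the union \<open>TM\<close> of
  the translates of \<open>M\<close> is closed, so that the \<open>T\<close>-orbit closure of \<open>x\<close> is the union of the
  translates of its \<open>H\<close>-orbit closure. For normal \<open>H\<close> the translates of an \<open>H\<close>-minimal set are
  \<open>H\<close>-minimal, hence a \<open>T\<close>-minimal set is covered by \<open>H\<close>-minimal sets; the subnormal case follows by
  descending along the chain, after replacing its members by their closures. Continuity of
  the orbit closure map is obtained from the closedness of \<open>TM\<close> in \<open>X \<times> X\<close>.\<close>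

section \<open>Co-compactness in terms of open covers\<close>

context topological_group
begin

lemma continuous_map_right_translation:
  assumes "h \<in> carrier G"
  shows "continuous_map \<tau> \<tau> (\<lambda>t. t \<otimes> h)"
proof -
  have "continuous_map \<tau> (prod_topology \<tau> \<tau>) (\<lambda>t. (t, h))"
    using assms by (simp add: continuous_map_paired topspace_eq_carrier)
  from continuous_map_compose[OF this continuous_mult] show ?thesis
    by (simp add: o_def)
qed

text \<open>The set \<open>V <#> H\<close> is the saturation of \<open>V\<close> under the map onto
  left cosets, so its openness says that this quotient map is open. It is the union of the right
  translates \<open>Vh\<close>, each an open preimage under translation by the inverse of
  \<open>h\<close>.\<close>

lemma openin_set_mult:
  assumes "openin \<tau> V" and "H \<subseteq> carrier G"
  shows "openin \<tau> (V <#> H)"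
proof -
  have V: "V \<subseteq> carrier G"
    using openin_subset[OF assms(1)] by (simp add: topspace_eq_carrier)
  have "V <#> H = (\<Union>h\<in>H. {t \<in> topspace \<tau>. t \<otimes> inv h \<in> V})"
  proof (intro equalityI subsetI)
    fix t assume "t \<in> V <#> H"
    then obtain v h where "v \<in> V" "h \<in> H" "t = v \<otimes> h"
      by (auto simp: set_mult_def)
    then show "t \<in> (\<Union>h\<in>H. {t \<in> topspace \<tau>. t \<otimes> inv h \<in> V})"
      using V assms(2) by (auto simp: topspace_eq_carrier m_assoc subset_iff intro!: bexI[of _ h])
  next
    fix t assume "t \<in> (\<Union>h\<in>H. {t \<in> topspace \<tau>. t \<otimes> inv h \<in> V})"
    then obtain h where "h \<in> H" "t \<in> carrier G" "t \<otimes> inv h \<in> V"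
      by (auto simp: topspace_eq_carrier)
    moreover from this have "t = (t \<otimes> inv h) \<otimes> h"
      using assms(2) by (simp add: m_assoc subset_iff)
    ultimately show "t \<in> V <#> H"
      unfolding set_mult_def by blast
  qed
  moreover have "openin \<tau> {t \<in> topspace \<tau>. t \<otimes> inv h \<in> V}" if "h \<in> H" for h
    using that assms by (intro openin_continuous_map_preimage[OF continuous_map_right_translation]) auto
  ultimately show ?thesis
    by auto
qed

lemma l_coset_in_image_iff:
  assumes "subgroup H G" and "V \<subseteq> carrier G" and "t \<in> carrier G"
  shows "t <# H \<in> (\<lambda>t. t <# H) ` V \<longleftrightarrow> t \<in> V <#> H"
proof
  assume "t <# H \<in> (\<lambda>t. t <# H) ` V"
  then obtain v where "v \<in> V" "t <# H = v <# H"
    by auto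
  then have "t \<in> v <# H"
    using lcos_self[OF assms(3,1)] by simp
  then show "t \<in> V <#> H"
    using \<open>v \<in> V\<close> by (auto simp: l_coset_def set_mult_def)
next
  assume "t \<in> V <#> H"
  then obtain v h where "v \<in> V" "h \<in> H" "t = v \<otimes> h"
    by (auto simp: set_mult_def)
  then have "t \<in> v <# H"
    by (auto simp: l_coset_def)
  then have "v <# H = t <# H"
    using l_repr_independence assms \<open>v \<in> V\<close> by blast
  then show "t <# H \<in> (\<lambda>t. t <# H) ` V"
    using \<open>v \<in> V\<close> by auto
qed

text \<open>Replaces the quotient topology by covers of the group itself: images under the open
  coset map turn a cover of the group into one of the coset space, and preimages go back. Since the
  group need not be compact, the finite subfamily covers only after multiplication by
  \<open>H\<close>.\<close>

lemma cocompact_iff_open_cover: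
  assumes "subgroup H G"
  shows "cocompact G \<tau> H \<longleftrightarrow>
    (\<forall>\<V>. (\<forall>V\<in>\<V>. openin \<tau> V) \<and> carrier G \<subseteq> \<Union>\<V> \<longrightarrow>
       (\<exists>\<F>. finite \<F> \<and> \<F> \<subseteq> \<V> \<and> carrier G \<subseteq> (\<Union>V\<in>\<F>. V <#> H)))"
    (is "_ \<longleftrightarrow> ?cover")
proof
  let ?\<pi> = "\<lambda>t. t <# H" and ?Q = "left_coset_space G \<tau> H"
  have openQ: "openin ?Q U \<longleftrightarrow> U \<subseteq> ?\<pi> ` carrier G \<and> openin \<tau> {t \<in> carrier G. ?\<pi> t \<in> U}" for U
    by (simp add: left_coset_space_def openin_quotient_topology topspace_eq_carrier)
  have topQ: "topspace ?Q = ?\<pi> ` carrier G"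
    by (simp add: left_coset_space_def topspace_eq_carrier)
  have H: "H \<subseteq> carrier G"
    using assms by (rule subgroup.subset)
  have sub: "V \<subseteq> carrier G" if "openin \<tau> V" for V
    using openin_subset[OF that] by (simp add: topspace_eq_carrier)
  {
    assume "cocompact G \<tau> H"
    then have comp: "compact_space ?Q"
      by (simp add: cocompact_def)
    show ?cover
    proof (intro allI impI, elim conjE)
      fix \<V> assume op: "\<forall>V\<in>\<V>. openin \<tau> V" and cov: "carrier G \<subseteq> \<Union>\<V>"
      have "openin ?Q (?\<pi> ` V)" if "V \<in> \<V>" for V
      proof -
        have V: "openin \<tau> V" "V \<subseteq> carrier G"
          using that op sub by auto
        have "V <#> H \<subseteq> carrier G"
          using V H by (simp add: set_mult_closed)
        then have "{t \<in> carrier G. ?\<pi> t \<in> ?\<pi> ` V} = V <#> H"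
          using l_coset_in_image_iff[OF assms V(2)] by auto
        then show ?thesis
          using V openin_set_mult[OF V(1) H] by (auto simp: openQ)
      qed
      moreover have "topspace ?Q \<subseteq> \<Union>((\<lambda>V. ?\<pi> ` V) ` \<V>)"
        using cov by (auto simp: topQ)
      ultimately obtain \<G> where \<G>: "finite \<G>" "\<G> \<subseteq> (\<lambda>V. ?\<pi> ` V) ` \<V>" "topspace ?Q \<subseteq> \<Union>\<G>"
        using comp unfolding compact_space_alt by (metis (no_types, lifting) imageE)
      obtain \<F> where \<F>: "finite \<F>" "\<F> \<subseteq> \<V>" "\<G> = (\<lambda>V. ?\<pi> ` V) ` \<F>"
        using finite_subset_image[OF \<G>(1,2)] by metis
      have "carrier G \<subseteq> (\<Union>V\<in>\<F>. V <#> H)"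
      proof
        fix t assume t: "t \<in> carrier G"
        then have "?\<pi> t \<in> \<Union>\<G>"
          using \<G>(3) topQ by auto
        then have "?\<pi> t \<in> \<Union>((\<lambda>V. ?\<pi> ` V) ` \<F>)"
          by (simp only: \<F>(3))
        then obtain V where "V \<in> \<F>" "?\<pi> t \<in> ?\<pi> ` V"
          by blast
        then show "t \<in> (\<Union>V\<in>\<F>. V <#> H)"
          using l_coset_in_image_iff[OF assms _ t] op sub \<F>(2) by blast
      qed
      then show "\<exists>\<F>. finite \<F> \<and> \<F> \<subseteq> \<V> \<and> carrier G \<subseteq> (\<Union>V\<in>\<F>. V <#> H)"
        using \<F> by blast
    qed
  next
    assume cover: ?cover
    show "cocompact G \<tau> H"
      unfolding cocompact_def compact_space_alt
    proof (intro allI impI, elim conjE)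
      fix \<U> assume op: "\<forall>U\<in>\<U>. openin ?Q U" and cov: "topspace ?Q \<subseteq> \<Union>\<U>"
      \<comment> \<open>The preimage \<open>p U\<close> is a union of left cosets, so multiplying it
        by \<open>H\<close> adds nothing and the finite cover descends to the coset space.\<close>
      define p where "p U = {t \<in> carrier G. ?\<pi> t \<in> U}" for U
      have "\<forall>V\<in>p ` \<U>. openin \<tau> V"
        using op by (auto simp: openQ p_def)
      moreover have "carrier G \<subseteq> \<Union>(p ` \<U>)"
        using cov by (auto simp: topQ p_def)
      ultimately obtain \<G> where \<G>: "finite \<G>" "\<G> \<subseteq> p ` \<U>" "carrier G \<subseteq> (\<Union>V\<in>\<G>. V <#> H)"
        using cover by meson
      obtain \<F> where \<F>: "finite \<F>" "\<F> \<subseteq> \<U>" "\<G> = p ` \<F>"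
        using finite_subset_image[OF \<G>(1,2)] by metis
      have "topspace ?Q \<subseteq> \<Union>\<F>"
      proof
        fix c assume "c \<in> topspace ?Q"
        then obtain t where t: "t \<in> carrier G" "c = ?\<pi> t"
          by (auto simp: topQ)
        then obtain U where U: "U \<in> \<F>" "t \<in> p U <#> H"
          using \<G>(3) unfolding \<F>(3) by auto
        then have "?\<pi> t \<in> ?\<pi> ` p U"
          using l_coset_in_image_iff[OF assms _ t(1)] by (auto simp: p_def)
        then have "c \<in> U"
          using t by (auto simp: p_def)
        then show "c \<in> \<Union>\<F>"
          using U by blast
      qed
      then show "\<exists>\<F>. finite \<F> \<and> \<F> \<subseteq> \<U> \<and> topspace ?Q \<subseteq> \<Union>\<F>"
        using \<F> by blast
    qed
  }
qed

text \<open>Passes co-compactness of the smallest group to each successive pair of a chain. As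
  \<open>L\<close> is closed, an open cover of \<open>L\<close> extends to one of the whole group by
  adjoining the complement of \<open>L\<close>; enlarging \<open>H\<close> to \<open>K\<close> only
  makes the saturations larger.\<close>

lemma cocompact_intermediate:
  assumes "subgroup H G" "subgroup K G" "subgroup L G" and "H \<subseteq> K" "K \<subseteq> L"
    and "closedin \<tau> L" and "cocompact G \<tau> H"
  shows "cocompact (G\<lparr>carrier := L\<rparr>) (subtopology \<tau> L) K"
proof -
  interpret L: topological_group "G\<lparr>carrier := L\<rparr>" "subtopology \<tau> L"
    using assms(3) by (rule topological_group_subgroup)
  have "subgroup K (G\<lparr>carrier := L\<rparr>)"
    using assms by (simp add: subgroup_incl)
  then show ?thesis
  proof (subst L.cocompact_iff_open_cover, simp, intro allI impI, elim conjE)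
    fix \<V> assume op: "\<forall>V\<in>\<V>. openin (subtopology \<tau> L) V"
      and cov: "carrier (G\<lparr>carrier := L\<rparr>) \<subseteq> \<Union>\<V>"
    let ?\<W> = "insert (carrier G - L) {W. openin \<tau> W \<and> W \<inter> L \<in> \<V>}"
    have "openin \<tau> (carrier G - L)"
      using assms(6) by (metis closedin_def topspace_eq_carrier)
    moreover have "carrier G \<subseteq> \<Union>?\<W>"
    proof
      fix t assume "t \<in> carrier G"
      show "t \<in> \<Union>?\<W>"
      proof (cases "t \<in> L")
        case True
        then obtain V where "V \<in> \<V>" "t \<in> V"
          using cov by auto
        moreover from this obtain W where "openin \<tau> W" "V = W \<inter> L"
          using op by (auto simp: openin_subtopology)
        ultimately show ?thesis
          by auto
      qed (use \<open>t \<in> carrier G\<close> in auto)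
    qed
    ultimately obtain \<F> where \<F>: "finite \<F>" "\<F> \<subseteq> ?\<W>" "carrier G \<subseteq> (\<Union>W\<in>\<F>. W <#> H)"
      using assms(7)[unfolded cocompact_iff_open_cover[OF assms(1)], rule_format, of ?\<W>] by auto
    let ?\<G> = "(\<lambda>W. W \<inter> L) ` (\<F> - {carrier G - L})"
    have "L \<subseteq> (\<Union>V\<in>?\<G>. V <#>\<^bsub>G\<lparr>carrier := L\<rparr>\<^esub> K)"
    proof
      fix t assume t: "t \<in> L"
      then have "t \<in> carrier G"
        using assms(3) subgroup.subset by blast
      then obtain W w h where W: "W \<in> \<F>" and w: "w \<in> W" and h: "h \<in> H" and th: "t = w \<otimes> h"
        using \<F>(3) by (force simp: set_mult_def)
      have "\<forall>W\<in>?\<W>. W \<subseteq> carrier G"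
        using openin_subset[of \<tau>] by (auto simp: topspace_eq_carrier)
      then have "w \<in> carrier G"
        using w W \<F>(2) by blast
      moreover have "h \<in> L" "h \<in> carrier G"
        using h assms subgroup.subset by blast+
      ultimately have "w = t \<otimes> inv h"
        using th by (simp add: m_assoc)
      then have "w \<in> L"
        using t \<open>h \<in> L\<close> assms(3) by (simp add: subgroup.m_closed subgroup.m_inv_closed)
      then have "W \<inter> L \<in> ?\<G>" "w \<in> W \<inter> L"
        using w W by auto
      moreover have "t \<in> (W \<inter> L) <#>\<^bsub>G\<lparr>carrier := L\<rparr>\<^esub> K"
        using \<open>w \<in> L\<close> w h th assms(4) by (auto simp: set_mult_def)
      ultimately show "t \<in> (\<Union>V\<in>?\<G>. V <#>\<^bsub>G\<lparr>carrier := L\<rparr>\<^esub> K)"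
        by blast
    qed
    then show "\<exists>\<F>. finite \<F> \<and> \<F> \<subseteq> \<V> \<and>
        carrier (G\<lparr>carrier := L\<rparr>) \<subseteq> (\<Union>V\<in>\<F>. V <#>\<^bsub>G\<lparr>carrier := L\<rparr>\<^esub> K)"
      using \<F>(1,2) by (intro exI[of _ ?\<G>]) auto
  qed
qed

section \<open>Closures of subgroups\<close>

lemma mult_closure_of:
  assumes "\<And>a b. a \<in> A \<Longrightarrow> b \<in> B \<Longrightarrow> a \<otimes> b \<in> C"
    and "a \<in> \<tau> closure_of A" and "b \<in> \<tau> closure_of B"
  shows "a \<otimes> b \<in> \<tau> closure_of C"
proof -
  have "(\<lambda>(s, t). s \<otimes> t) ` (prod_topology \<tau> \<tau> closure_of (A \<times> B)) \<subseteq>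
      \<tau> closure_of ((\<lambda>(s, t). s \<otimes> t) ` (A \<times> B))"
    using continuous_mult by (rule continuous_map_image_closure_subset)
  also have "\<dots> \<subseteq> \<tau> closure_of C"
    using assms(1) by (intro closure_of_mono) auto
  finally show ?thesis
    using assms(2,3) by (force simp: closure_of_Times)
qed

lemma inv_closure_of:
  assumes "a \<in> \<tau> closure_of A" and "\<And>a. a \<in> A \<Longrightarrow> inv a \<in> B"
  shows "inv a \<in> \<tau> closure_of B"
proof -
  have "(\<lambda>t. inv t) ` (\<tau> closure_of A) \<subseteq> \<tau> closure_of ((\<lambda>t. inv t) ` A)"
    using continuous_inv by (rule continuous_map_image_closure_subset)
  also have "\<dots> \<subseteq> \<tau> closure_of B"
    using assms(2) by (intro closure_of_mono) auto
  finally show ?thesis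
    using assms(1) by auto
qed

lemma subset_closure_of_subgroup:
  assumes "subgroup H G"
  shows "H \<subseteq> \<tau> closure_of H"
  using assms by (simp add: closure_of_subset subgroup.subset topspace_eq_carrier)

lemma closure_of_subset_carrier: "\<tau> closure_of A \<subseteq> carrier G"
  using closure_of_subset_topspace[of \<tau> A] by (simp add: topspace_eq_carrier)

lemma subgroup_closure_of:
  assumes "subgroup H G"
  shows "subgroup (\<tau> closure_of H) G"
proof (rule subgroupI)
  show "\<tau> closure_of H \<subseteq> carrier G"
    by (rule closure_of_subset_carrier)
  show "\<tau> closure_of H \<noteq> {}"
    using subset_closure_of_subgroup[OF assms] subgroup.one_closed[OF assms] by auto
  show "inv a \<in> \<tau> closure_of H" if "a \<in> \<tau> closure_of H" for a
    using that subgroup.m_inv_closed[OF assms] by (rule inv_closure_of)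
  show "a \<otimes> b \<in> \<tau> closure_of H" if "a \<in> \<tau> closure_of H" "b \<in> \<tau> closure_of H" for a b
    using subgroup.m_closed[OF assms] that by (rule mult_closure_of)
qed

text \<open>Allows the members of a subnormal chain to be replaced by their closures. The map
  sending \<open>(k, h)\<close> to the conjugate of \<open>h\<close> by \<open>k\<close> is jointly
  continuous and sends \<open>K\<close> x \<open>H\<close> into \<open>H\<close>, hence sends the
  product of the closures into the closure of \<open>H\<close>.\<close>

lemma normal_closure_of:
  assumes "subgroup H G" "subgroup K G" and normal: "H \<lhd> G\<lparr>carrier := K\<rparr>"
  shows "\<tau> closure_of H \<lhd> G\<lparr>carrier := \<tau> closure_of K\<rparr>"
proof -
  let ?H = "\<tau> closure_of H" and ?K = "\<tau> closure_of K"
  have K: "subgroup ?K G"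
    using assms(2) by (rule subgroup_closure_of)
  interpret K: group "G\<lparr>carrier := ?K\<rparr>"
    using K by (rule subgroup_imp_group)
  have "H \<subseteq> K"
    using subgroup.subset[OF normal_imp_subgroup[OF normal]] by simp
  then have "subgroup ?H (G\<lparr>carrier := ?K\<rparr>)"
    using subgroup_closure_of assms(1,2) by (intro subgroup_incl closure_of_mono)
  moreover have "k \<otimes> h \<otimes> inv k \<in> ?H" if "k \<in> ?K" "h \<in> ?H" for k h
  proof -
    have "continuous_map (prod_topology \<tau> \<tau>) (prod_topology \<tau> \<tau>)
        (\<lambda>p. ((\<lambda>(s, t). s \<otimes> t) p, inv (fst p)))"
      using continuous_mult continuous_map_compose[OF continuous_map_fst continuous_inv]
      by (simp add: continuous_map_paired o_def)
    from continuous_map_compose[OF this continuous_mult]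
    have "continuous_map (prod_topology \<tau> \<tau>) \<tau> (\<lambda>(k, h). k \<otimes> h \<otimes> inv k)"
      by (simp add: o_def case_prod_unfold)
    then have "(\<lambda>(k, h). k \<otimes> h \<otimes> inv k) ` (prod_topology \<tau> \<tau> closure_of (K \<times> H)) \<subseteq>
        \<tau> closure_of ((\<lambda>(k, h). k \<otimes> h \<otimes> inv k) ` (K \<times> H))"
      by (rule continuous_map_image_closure_subset)
    also have "\<dots> \<subseteq> ?H"
      using normal.inv_op_closed2[OF normal] assms(2)
      by (intro closure_of_mono) auto
    finally show ?thesis
      using that by (force simp: closure_of_Times)
  qed
  ultimately show ?thesis
    using K by (simp add: K.normal_inv_iff)
qed

end

section \<open>Orbit closures and almost periodic points\<close>

context flow
begin

lemma act_closed:
  assumes "t \<in> carrier G" "x \<in> topspace X"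
  shows "act t x \<in> topspace X"
proof -
  have "(\<lambda>(t, x). act t x) \<in> topspace (prod_topology \<tau> X) \<rightarrow> topspace X"
    using continuous_act by (rule continuous_map_funspace)
  then show ?thesis
    using assms by (auto simp: topspace_eq_carrier Pi_iff)
qed

lemma act_inv_act:
  assumes "t \<in> carrier G" "x \<in> topspace X"
  shows "act (inv t) (act t x) = x"
  using assms act_mult[of "inv t" t x] by (simp add: act_one)

lemma act_act_inv:
  assumes "t \<in> carrier G" "x \<in> topspace X"
  shows "act t (act (inv t) x) = x"
  using assms act_mult[of t "inv t" x] by (simp add: act_one)

lemma continuous_map_act:
  assumes "t \<in> carrier G"
  shows "continuous_map X X (act t)"
proof -
  have "continuous_map X (prod_topology \<tau> X) (\<lambda>x. (t, x))"
    using assms by (simp add: continuous_map_paired topspace_eq_carrier)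
  from continuous_map_compose[OF this continuous_act] show ?thesis
    by (simp add: o_def)
qed

lemma closedin_orbit_closure: "closedin X (orbit_closure G X act x)"
  by (simp add: orbit_closure_def)

lemma orbit_closure_subset_topspace: "orbit_closure G X act x \<subseteq> topspace X"
  by (simp add: orbit_closure_def closure_of_subset_topspace)

lemma orbit_subset_orbit_closure:
  assumes "x \<in> topspace X" "t \<in> carrier G"
  shows "act t x \<in> orbit_closure G X act x"
proof -
  have "(\<lambda>t. act t x) ` carrier G \<subseteq> orbit_closure G X act x"
    unfolding orbit_closure_def using assms(1) by (intro closure_of_subset) (auto simp: act_closed)
  then show ?thesis
    using assms(2) by auto
qed

lemma self_in_orbit_closure:
  assumes "x \<in> topspace X"
  shows "x \<in> orbit_closure G X act x"
  using orbit_subset_orbit_closure[OF assms, of \<one>] assms by (simp add: act_one)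

lemma orbit_closure_minimal:
  assumes "closedin X C" "x \<in> C" "\<And>t y. t \<in> carrier G \<Longrightarrow> y \<in> C \<Longrightarrow> act t y \<in> C"
  shows "orbit_closure G X act x \<subseteq> C"
  unfolding orbit_closure_def using assms by (intro closure_of_minimal) auto

lemma orbit_closure_invariant:
  assumes "x \<in> topspace X" "y \<in> orbit_closure G X act x" "t \<in> carrier G"
  shows "act t y \<in> orbit_closure G X act x"
proof -
  have "act t ` (X closure_of ((\<lambda>t. act t x) ` carrier G)) \<subseteq>
      X closure_of (act t ` (\<lambda>t. act t x) ` carrier G)"
    using continuous_map_act[OF assms(3)] by (rule continuous_map_image_closure_subset)
  also have "act t ` (\<lambda>t. act t x) ` carrier G \<subseteq> (\<lambda>t. act t x) ` carrier G"
    using assms by (auto simp: act_mult[symmetric])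
  then have "X closure_of (act t ` (\<lambda>t. act t x) ` carrier G) \<subseteq>
      X closure_of ((\<lambda>t. act t x) ` carrier G)"
    by (rule closure_of_mono)
  finally show ?thesis
    using assms(2) by (auto simp: orbit_closure_def)
qed

lemma orbit_closure_mono:
  assumes "x \<in> topspace X" "y \<in> orbit_closure G X act x"
  shows "orbit_closure G X act y \<subseteq> orbit_closure G X act x"
  using closedin_orbit_closure assms(2) orbit_closure_invariant[OF assms(1)]
  by (rule orbit_closure_minimal)

text \<open>By normality \<open>tn = (t n inv t) t\<close>, so translation by \<open>t\<close>
  carries \<open>N\<close>-orbits to \<open>N\<close>-orbits, and as a homeomorphism it carries
  their closures along.\<close>

lemma image_orbit_closure:
  assumes N: "N \<lhd> G" and t: "t \<in> carrier G" and x: "x \<in> topspace X"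
  shows "act t ` orbit_closure (G\<lparr>carrier := N\<rparr>) X act x =
    orbit_closure (G\<lparr>carrier := N\<rparr>) X act (act t x)"
proof -
  let ?O = "orbit_closure (G\<lparr>carrier := N\<rparr>) X act"
  have sub: "subgroup N G"
    using N by (rule normal_imp_subgroup)
  interpret N: flow "G\<lparr>carrier := N\<rparr>" "subtopology \<tau> N" X act
    using sub by (rule flow_subgroup)
  \<comment> \<open>The claim is stated for fresh \<open>t\<close> and \<open>x\<close> because the
    reverse inclusion is this one applied to \<open>inv t\<close> and
    \<open>act t x\<close>.\<close>
  have incl: "act t z \<in> ?O (act t x)"
    if t: "t \<in> carrier G" and x: "x \<in> topspace X" and z: "z \<in> ?O x" for t x z
  proof -
    have "?O x \<subseteq> {z \<in> topspace X. act t z \<in> ?O (act t x)}"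
    proof (rule N.orbit_closure_minimal)
      show "closedin X {z \<in> topspace X. act t z \<in> ?O (act t x)}"
        using continuous_map_act[OF t] N.closedin_orbit_closure
        by (rule closedin_continuous_map_preimage)
      show "x \<in> {z \<in> topspace X. act t z \<in> ?O (act t x)}"
        using t x by (simp add: N.self_in_orbit_closure act_closed)
    next
      fix n z assume n: "n \<in> carrier (G\<lparr>carrier := N\<rparr>)"
        and z: "z \<in> {z \<in> topspace X. act t z \<in> ?O (act t x)}"
      have nG: "n \<in> carrier G"
        using n subgroup.subset[OF sub] by auto
      have conj: "t \<otimes> n \<otimes> inv t \<in> N"
        using normal.inv_op_closed2[OF N t] n by simp
      have "act t (act n z) = act (t \<otimes> n \<otimes> inv t) (act t z)"
        using t nG z by (simp add: act_mult act_closed act_inv_act)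
      also have "\<dots> \<in> ?O (act t x)"
        by (rule N.orbit_closure_invariant) (use z conj t x act_closed in auto)
      finally show "act n z \<in> {z \<in> topspace X. act t z \<in> ?O (act t x)}"
        using z nG by (simp add: act_closed)
    qed
    then show ?thesis
      using z by auto
  qed
  show ?thesis
  proof (intro equalityI subsetI)
    fix y assume "y \<in> act t ` ?O x"
    then show "y \<in> ?O (act t x)"
      using incl t x by auto
  next
    fix y assume y: "y \<in> ?O (act t x)"
    then have "act (inv t) y \<in> ?O (act (inv t) (act t x))"
      using t x by (intro incl) (auto simp: act_closed)
    moreover have "y = act t (act (inv t) y)"
      using y t N.orbit_closure_subset_topspace by (subst act_act_inv) auto
    ultimately show "y \<in> act t ` ?O x"
      using t x by (auto simp: act_inv_act)
  qed
qed

text \<open>The right-hand side is minimality of the orbit closure of \<open>x\<close>: by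
  \<open>orbit_closure_mono\<close> each of its points has the same orbit closure. Later arguments
  use only this form and never return to syndetic sets.\<close>

lemma almost_periodic_iff:
  assumes "compact_space X" "Hausdorff_space X" and x: "x \<in> topspace X"
  shows "almost_periodic G \<tau> X act x \<longleftrightarrow>
    (\<forall>y \<in> orbit_closure G X act x. x \<in> orbit_closure G X act y)"
proof
  assume ap: "almost_periodic G \<tau> X act x"
  show "\<forall>y \<in> orbit_closure G X act x. x \<in> orbit_closure G X act y"
  proof (rule ballI, rule ccontr)
    fix y assume y: "y \<in> orbit_closure G X act x" and not: "x \<notin> orbit_closure G X act y"
    have yX: "y \<in> topspace X"
      using y orbit_closure_subset_topspace by auto
    have "compactin X (orbit_closure G X act y)"
      using assms(1) closedin_orbit_closure by (rule closedin_compact_space)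
    then obtain U V where UV: "openin X U" "openin X V" "x \<in> U" "orbit_closure G X act y \<subseteq> V"
        "disjnt U V"
      using Hausdorff_space_compact_separation[OF assms(2), of "{x}" "orbit_closure G X act y"] x not
      by auto
    \<comment> \<open>The complement of \<open>V\<close> is a closed, hence compact, neighbourhood
      of \<open>x\<close> that misses the orbit closure of \<open>y\<close>.\<close>
    define C where "C = topspace X - V"
    have C: "closedin X C" "U \<subseteq> C" "C \<subseteq> topspace X"
      using UV openin_subset[OF UV(1)] by (auto simp: C_def disjnt_def)
    have "x \<in> X interior_of C"
      using UV(1,3) C(2) by (auto simp: interior_of_def)
    then have "syndetic G \<tau> {t \<in> carrier G. act t x \<in> C}"
      using ap C(3) by (auto simp: almost_periodic_def)
    then obtain K where K: "compactin \<tau> K"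
        "carrier G = (set_inv K) <#> {t \<in> carrier G. act t x \<in> C}"
      by (auto simp: syndetic_def)
    have KG: "K \<subseteq> carrier G"
      using compactin_subset_topspace[OF K(1)] by (simp add: topspace_eq_carrier)
    \<comment> \<open>Syndeticity puts the orbit of \<open>x\<close> into the set of all
      \<open>act (inv k) c\<close> with \<open>k\<close> in \<open>K\<close> and \<open>c\<close> in
      \<open>C\<close>. This set is compact, hence closed, so it also contains \<open>y\<close>;
      then \<open>c = act k y\<close> lies both in \<open>C\<close> and in the orbit closure of
      \<open>y\<close>.\<close>
    let ?D = "(\<lambda>(t, x). act t x) ` ((\<lambda>k. inv k) ` K \<times> C)"
    have "compactin \<tau> ((\<lambda>k. inv k) ` K)"
      using K(1) continuous_inv by (rule image_compactin)
    moreover have "compactin X C"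
      using assms(1) C(1) by (rule closedin_compact_space)
    ultimately have "compactin X ?D"
      by (intro image_compactin[OF _ continuous_act]) (simp add: compactin_Times)
    then have D: "closedin X ?D"
      using assms(2) by (rule compactin_imp_closedin[rotated])
    have "act s x \<in> ?D" if "s \<in> carrier G" for s
    proof -
      obtain k t where k: "k \<in> K" and t: "t \<in> carrier G" "act t x \<in> C" and "s = inv k \<otimes> t"
        using equalityD1[OF K(2), THEN subsetD, OF \<open>s \<in> carrier G\<close>]
        by (auto simp: set_mult_def SET_INV_def)
      then have "act s x = act (inv k) (act t x)"
        using KG x by (auto simp: act_mult)
      then show ?thesis
        using k t by force
    qed
    then have "orbit_closure G X act x \<subseteq> ?D"
      unfolding orbit_closure_def using D by (intro closure_of_minimal) auto
    then obtain k c where k: "k \<in> K" and c: "c \<in> C" and "y = act (inv k) c"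
      using y by auto
    then have "act k y = c"
      using KG C(3) by (simp add: act_act_inv subset_iff)
    then have "c \<in> orbit_closure G X act y"
      using orbit_subset_orbit_closure[OF yX] k KG by auto
    then show False
      using c UV(4) by (auto simp: C_def)
  qed
next
  assume min: "\<forall>y \<in> orbit_closure G X act x. x \<in> orbit_closure G X act y"
  show "almost_periodic G \<tau> X act x"
    unfolding almost_periodic_def
  proof (intro allI impI, elim conjE)
    fix U assume UX: "U \<subseteq> topspace X" and xU: "x \<in> X interior_of U"
    \<comment> \<open>The open set \<open>W t\<close> consists of the points that \<open>t\<close>
      moves into the interior of \<open>U\<close>. These sets cover the orbit closure of
      \<open>x\<close>, because every orbit in it accumulates at \<open>x\<close>.\<close>
    define W where "W t = {y \<in> topspace X. act t y \<in> X interior_of U}" for t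
    have comp: "compactin X (orbit_closure G X act x)"
      using assms(1) closedin_orbit_closure by (rule closedin_compact_space)
    have op: "openin X V" if "V \<in> W ` carrier G" for V
      using that by (auto simp: W_def intro!: openin_continuous_map_preimage[OF continuous_map_act])
    have "orbit_closure G X act x \<subseteq> \<Union>(W ` carrier G)"
    proof
      fix y assume y: "y \<in> orbit_closure G X act x"
      then have "x \<in> X closure_of ((\<lambda>t. act t y) ` carrier G)"
        using min by (simp add: orbit_closure_def)
      then obtain t where "t \<in> carrier G" "act t y \<in> X interior_of U"
        using xU openin_interior_of[of X U] unfolding in_closure_of by blast
      then show "y \<in> \<Union>(W ` carrier G)"
        using y orbit_closure_subset_topspace by (auto simp: W_def)
    qed
    with comp op
    have "\<exists>\<W>. finite \<W> \<and> \<W> \<subseteq> W ` carrier G \<and> orbit_closure G X act x \<subseteq> \<Union>\<W>"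
      by (rule compactinD)
    then obtain \<W> where \<W>: "finite \<W>" "\<W> \<subseteq> W ` carrier G"
        and cov: "orbit_closure G X act x \<subseteq> \<Union>\<W>"
      by metis
    \<comment> \<open>The finite index set \<open>F\<close> is the compact set required for
      syndeticity: \<open>s\<close> is \<open>inv t\<close> times \<open>t \<otimes> s\<close>,
      where \<open>t \<otimes> s\<close> is a return time to \<open>U\<close>.\<close>
    obtain F where F: "F \<subseteq> carrier G" "finite F" "\<W> = W ` F"
      using finite_subset_image[OF \<W>] by metis
    have cover: "\<exists>t\<in>F. act t (act s x) \<in> X interior_of U" if "s \<in> carrier G" for s
      using orbit_subset_orbit_closure[OF x that] cov by (auto simp: F(3) W_def)
    have "F \<noteq> {}"
      using cover[of \<one>] by auto
    moreover have "compactin \<tau> F"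
      using F by (simp add: finite_imp_compactin topspace_eq_carrier)
    moreover have "carrier G = (set_inv F) <#> {t \<in> carrier G. act t x \<in> U}"
    proof (intro equalityI subsetI)
      fix s assume s: "s \<in> carrier G"
      then obtain t where t: "t \<in> F" "act t (act s x) \<in> X interior_of U"
        using cover by auto
      have tG: "t \<in> carrier G"
        using t(1) F(1) by auto
      have "act (t \<otimes> s) x \<in> U"
        using t(2) s tG x interior_of_subset[of X U] by (auto simp: act_mult)
      moreover have "s = inv t \<otimes> (t \<otimes> s)"
        using s tG by (simp add: m_assoc[symmetric])
      moreover have "inv t \<in> set_inv F"
        using t(1) by (auto simp: SET_INV_def)
      ultimately show "s \<in> (set_inv F) <#> {t \<in> carrier G. act t x \<in> U}"
        using s tG unfolding set_mult_def by blast
    next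
      fix s assume "s \<in> (set_inv F) <#> {t \<in> carrier G. act t x \<in> U}"
      then show "s \<in> carrier G"
        using F(1) by (auto simp: set_mult_def SET_INV_def)
    qed
    ultimately show "syndetic G \<tau> {t \<in> carrier G. act t x \<in> U}"
      unfolding syndetic_def by blast
  qed
qed

section \<open>Existence of minimal sets\<close>

lemma exists_minimal_subset:
  assumes "compactin X Y" "closedin X Y" "Y \<noteq> {}"
    and inv: "\<And>t y. t \<in> carrier G \<Longrightarrow> y \<in> Y \<Longrightarrow> act t y \<in> Y"
  obtains z where "z \<in> Y" "\<And>y. y \<in> orbit_closure G X act z \<Longrightarrow> z \<in> orbit_closure G X act y"
proof -
  \<comment> \<open>Zorn's lemma is applied to the complements of the invariant closed sets that meet \<open>Y\<close>.\<close>
  define \<A> where "\<A> = {U. openin X U \<and> \<not> Y \<subseteq> U \<and> (\<forall>t\<in>carrier G. \<forall>y\<in>U. act t y \<in> U)}"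
  have "{} \<in> \<A>"
    using assms(3) by (auto simp: \<A>_def)
  moreover have "\<Union>\<C> \<in> \<A>" if "\<C> \<noteq> {}" "subset.chain \<A> \<C>" for \<C>
  proof -
    have \<C>: "\<C> \<subseteq> \<A>"
      using that(2) by (simp add: subset.chain_def)
    \<comment> \<open>If the union of the chain contained \<open>Y\<close>, then by compactness so
      would a finite subfamily, and a finite chain contains its own union; but no member of the
      chain contains \<open>Y\<close>.\<close>
    have "\<not> Y \<subseteq> \<Union>\<C>"
    proof
      assume "Y \<subseteq> \<Union>\<C>"
      moreover have "\<forall>U\<in>\<C>. openin X U"
        using \<C> by (auto simp: \<A>_def)
      ultimately obtain \<F> where \<F>: "finite \<F>" "\<F> \<subseteq> \<C>" "Y \<subseteq> \<Union>\<F>"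
        using compactinD[OF assms(1), of \<C>] by blast
      have "\<F> \<noteq> {}"
        using \<F>(3) assms(3) by auto
      moreover have "subset.chain \<A> \<F>"
        using that(2) \<F>(2) by (simp add: subset_chain_def subset_iff)
      ultimately have "\<Union>\<F> \<in> \<F>"
        using \<F>(1) by (intro Union_in_chain)
      then show False
        using \<F>(2,3) \<C> by (auto simp: \<A>_def)
    qed
    then show ?thesis
      using \<C> unfolding \<A>_def by blast
  qed
  ultimately obtain U where U: "U \<in> \<A>" and max: "\<And>V. V \<in> \<A> \<Longrightarrow> U \<subseteq> V \<Longrightarrow> V = U"
    using subset_Zorn_nonempty[of \<A>] by blast
  have YX: "Y \<subseteq> topspace X"
    using assms(2) by (rule closedin_subset)
  have closed: "closedin X (Y - U)"
    using assms(2) U by (auto simp: \<A>_def)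
  have invM: "act t y \<in> Y - U" if "t \<in> carrier G" "y \<in> Y - U" for t y
  proof -
    have "act t y \<notin> U"
    proof
      assume "act t y \<in> U"
      then have "act (inv t) (act t y) \<in> U"
        using U that(1) by (auto simp: \<A>_def)
      then show False
        using that YX by (auto simp: act_inv_act)
    qed
    then show ?thesis
      using that inv by auto
  qed
  \<comment> \<open>Adjoining to \<open>U\<close> the complement of the orbit closure of
    \<open>y\<close> gives an invariant open set that still omits \<open>y\<close>. By maximality of
    \<open>U\<close> that complement already lies in \<open>U\<close>.\<close>
  have min: "Y - U \<subseteq> orbit_closure G X act y" if y: "y \<in> Y - U" for y
  proof -
    let ?C = "orbit_closure G X act y"
    have yX: "y \<in> topspace X"
      using y YX by auto
    have "act t z \<in> topspace X - ?C" if "t \<in> carrier G" "z \<in> topspace X - ?C" for t z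
    proof -
      have "act t z \<notin> ?C"
      proof
        assume "act t z \<in> ?C"
        then have "act (inv t) (act t z) \<in> ?C"
          using yX that(1) by (auto intro: orbit_closure_invariant)
        then show False
          using that by (auto simp: act_inv_act)
      qed
      then show ?thesis
        using that by (auto simp: act_closed)
    qed
    moreover have "\<not> Y \<subseteq> U \<union> (topspace X - ?C)"
      using y self_in_orbit_closure[OF yX] by auto
    moreover have "openin X (U \<union> (topspace X - ?C))"
      using U closedin_orbit_closure by (auto simp: \<A>_def closedin_def)
    ultimately have "U \<union> (topspace X - ?C) \<in> \<A>"
      using U unfolding \<A>_def by blast
    then have "U \<union> (topspace X - ?C) = U"
      by (rule max) auto
    then show ?thesis
      using YX by auto
  qed
  obtain z where z: "z \<in> Y - U"
    using U by (auto simp: \<A>_def)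
  have "orbit_closure G X act z \<subseteq> Y - U"
    using closed z invM by (rule orbit_closure_minimal)
  then show thesis
    using z min that by blast
qed

section \<open>Co-compact subgroups\<close>

text \<open>A tube argument in which co-compactness of \<open>H\<close> replaces compactness of the
  group. For \<open>y\<close> outside the translates, finitely many products of open sets
  \<open>V\<close> and \<open>W\<close> suffice once each \<open>V\<close> is saturated by
  \<open>H\<close>, and the \<open>H\<close>-invariance of \<open>M\<close> absorbs the
  saturation.\<close>

lemma closedin_translates:
  assumes "subgroup H G" "cocompact G \<tau> H" "closedin X M"
    and inv: "\<And>h m. h \<in> H \<Longrightarrow> m \<in> M \<Longrightarrow> act h m \<in> M"
  shows "closedin X (\<Union>t\<in>carrier G. act t ` M)"
proof -
  let ?TM = "\<Union>t\<in>carrier G. act t ` M"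
  have MX: "M \<subseteq> topspace X"
    using assms(3) by (rule closedin_subset)
  have "\<exists>W. openin X W \<and> y \<in> W \<and> W \<subseteq> topspace X - ?TM" if y: "y \<in> topspace X - ?TM" for y
  proof -
    \<comment> \<open>In other words, \<open>W\<close> is a neighbourhood of \<open>y\<close> that
      misses every translate of \<open>M\<close> by an element of \<open>V\<close>.\<close>
    define good where "good V W \<longleftrightarrow> openin X W \<and> y \<in> W \<and> (\<forall>v\<in>V. \<forall>w\<in>W. act (inv v) w \<notin> M)"
      for V W
    define \<V> where "\<V> = {V. openin \<tau> V \<and> (\<exists>W. good V W)}"
    have cont: "continuous_map (prod_topology \<tau> X) X (\<lambda>(t, x). act (inv t) x)"
    proof -
      have "continuous_map (prod_topology \<tau> X) (prod_topology \<tau> X) (\<lambda>p. (inv (fst p), snd p))"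
        using continuous_map_compose[OF continuous_map_fst continuous_inv]
        by (simp add: continuous_map_paired o_def continuous_map_snd)
      from continuous_map_compose[OF this continuous_act] show ?thesis
        by (simp add: o_def case_prod_unfold)
    qed
    have "openin (prod_topology \<tau> X)
        {p \<in> topspace (prod_topology \<tau> X). (\<lambda>(t, x). act (inv t) x) p \<in> topspace X - M}"
      using cont assms(3) by (intro openin_continuous_map_preimage) auto
    then have op: "openin (prod_topology \<tau> X)
        {p \<in> carrier G \<times> topspace X. act (inv (fst p)) (snd p) \<in> topspace X - M}"
      by (simp add: case_prod_unfold topspace_eq_carrier)
    have "carrier G \<subseteq> \<Union>\<V>"
    proof
      fix t assume t: "t \<in> carrier G"
      have "act (inv t) y \<notin> M"
      proof
        assume "act (inv t) y \<in> M"
        then have "act t (act (inv t) y) \<in> ?TM"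
          using t by blast
        then show False
          using t y by (simp add: act_act_inv)
      qed
      then have "(t, y) \<in> {p \<in> carrier G \<times> topspace X. act (inv (fst p)) (snd p) \<in> topspace X - M}"
        using t y by (simp add: act_closed)
      then obtain V W where "openin \<tau> V" "openin X W" "t \<in> V" "y \<in> W"
          "V \<times> W \<subseteq> {p \<in> carrier G \<times> topspace X. act (inv (fst p)) (snd p) \<in> topspace X - M}"
        using op unfolding openin_prod_topology_alt by meson
      then show "t \<in> \<Union>\<V>"
        by (force simp: \<V>_def good_def)
    qed
    moreover have "\<forall>V\<in>\<V>. openin \<tau> V"
      by (simp add: \<V>_def)
    ultimately obtain \<F> where \<F>: "finite \<F>" "\<F> \<subseteq> \<V>" "carrier G \<subseteq> (\<Union>V\<in>\<F>. V <#> H)"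
      using assms(2) unfolding cocompact_iff_open_cover[OF assms(1)] by meson
    obtain w where w: "\<And>V. V \<in> \<F> \<Longrightarrow> good V (w V)"
      using \<F>(2) unfolding \<V>_def subset_iff mem_Collect_eq by metis
    let ?W = "\<Inter>(insert (topspace X) (w ` \<F>))"
    have "openin X ?W"
      using \<F>(1) w by (intro openin_Inter) (auto simp: good_def)
    moreover have "y \<in> ?W"
      using y w by (auto simp: good_def)
    moreover have "?W \<subseteq> topspace X - ?TM"
    proof
      fix z assume z: "z \<in> ?W"
      have "z \<notin> ?TM"
      proof
        assume "z \<in> ?TM"
        then obtain t m where t: "t \<in> carrier G" and m: "m \<in> M" and ztm: "z = act t m"
          by auto
        obtain V v h where V: "V \<in> \<F>" and v: "v \<in> V" and h: "h \<in> H" and tvh: "t = v \<otimes> h"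
          using t \<F>(3) by (force simp: set_mult_def)
        have "openin \<tau> V"
          using V \<F>(2) by (auto simp: \<V>_def)
        then have vG: "v \<in> carrier G"
          using v openin_subset[of \<tau> V] by (auto simp: topspace_eq_carrier)
        have hG: "h \<in> carrier G"
          using h subgroup.subset[OF assms(1)] by auto
        \<comment> \<open>With \<open>t\<close> equal to \<open>v\<close> times \<open>h\<close>,
          the factor \<open>h\<close> acts on \<open>m\<close> inside \<open>M\<close>, so only the
          representative \<open>v\<close> from the finite subfamily matters.\<close>
        have "act (inv v) z = act h m"
          using vG hG m MX by (auto simp: ztm tvh act_mult act_inv_act act_closed)
        then have "act (inv v) z \<in> M"
          using inv[OF h m] by simp
        moreover have "z \<in> w V"
          using z V by auto
        ultimately show False
          using w[OF V] v by (auto simp: good_def)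
      qed
      then show "z \<in> topspace X - ?TM"
        using z by auto
    qed
    ultimately show ?thesis
      by blast
  qed
  then have "openin X (topspace X - ?TM)"
    by (subst openin_subopen) blast
  moreover have "?TM \<subseteq> topspace X"
    using MX by (auto simp: act_closed)
  ultimately show ?thesis
    by (simp add: closedin_def)
qed

text \<open>The union of the translates is closed by \<open>closedin_translates\<close> and contains
  the orbit of \<open>x\<close>; conversely the orbit closure under the whole group contains the
  \<open>H\<close>-orbit closure and is invariant.\<close>

lemma orbit_closure_eq_translates:
  assumes "subgroup H G" "cocompact G \<tau> H" and x: "x \<in> topspace X"
  shows "orbit_closure G X act x =
    (\<Union>t\<in>carrier G. act t ` orbit_closure (G\<lparr>carrier := H\<rparr>) X act x)"
proof -
  let ?O = "orbit_closure (G\<lparr>carrier := H\<rparr>) X act"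
  interpret H: flow "G\<lparr>carrier := H\<rparr>" "subtopology \<tau> H" X act
    using assms(1) by (rule flow_subgroup)
  have sub: "?O x \<subseteq> orbit_closure G X act x"
    using subgroup.subset[OF assms(1)] by (auto simp: orbit_closure_def intro!: closure_of_mono)
  have "closedin X (\<Union>t\<in>carrier G. act t ` ?O x)"
    using assms(1,2) H.closedin_orbit_closure
    by (rule closedin_translates) (use H.orbit_closure_invariant[OF x] in simp)
  moreover have "act s x \<in> (\<Union>t\<in>carrier G. act t ` ?O x)" if "s \<in> carrier G" for s
    using that H.self_in_orbit_closure[OF x] by blast
  ultimately have "orbit_closure G X act x \<subseteq> (\<Union>t\<in>carrier G. act t ` ?O x)"
    unfolding orbit_closure_def[of G] by (intro closure_of_minimal) auto
  moreover have "(\<Union>t\<in>carrier G. act t ` ?O x) \<subseteq> orbit_closure G X act x"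
    using sub orbit_closure_invariant[OF x] by auto
  ultimately show ?thesis
    by blast
qed

section \<open>Almost periodicity under a group and its co-compact subgroups\<close>

lemma almost_periodic_of_cocompact_subgroup:
  assumes "compact_space X" "Hausdorff_space X" "subgroup H G" "cocompact G \<tau> H"
    and x: "x \<in> topspace X" and ap: "almost_periodic (G\<lparr>carrier := H\<rparr>) (subtopology \<tau> H) X act x"
  shows "almost_periodic G \<tau> X act x"
proof -
  let ?O = "orbit_closure (G\<lparr>carrier := H\<rparr>) X act"
  interpret H: flow "G\<lparr>carrier := H\<rparr>" "subtopology \<tau> H" X act
    using assms(3) by (rule flow_subgroup)
  \<comment> \<open>Here \<open>y\<close> is \<open>act t z\<close> with \<open>z\<close> in the
    \<open>H\<close>-orbit closure of \<open>x\<close>. The element \<open>inv t\<close> leads from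
    \<open>y\<close> back to \<open>z\<close>, and almost periodicity under \<open>H\<close> leads
    from \<open>z\<close> back to \<open>x\<close>.\<close>
  have "x \<in> orbit_closure G X act y" if y_in: "y \<in> orbit_closure G X act x" for y
  proof -
    obtain t z where t: "t \<in> carrier G" and z: "z \<in> ?O x" and y: "y = act t z"
      using y_in unfolding orbit_closure_eq_translates[OF assms(3,4) x] by auto
    have zX: "z \<in> topspace X"
      using z H.orbit_closure_subset_topspace by auto
    have yX: "y \<in> topspace X"
      using y_in orbit_closure_subset_topspace by auto
    have "z \<in> orbit_closure G X act y"
      using orbit_subset_orbit_closure[OF yX, of "inv t"] t zX by (simp add: y act_inv_act)
    moreover have "x \<in> ?O z"
      using ap z H.almost_periodic_iff[OF assms(1,2) x] by auto
    then have "act \<one> x \<in> orbit_closure G X act z"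
      unfolding orbit_closure_eq_translates[OF assms(3,4) zX] by blast
    then have "x \<in> orbit_closure G X act z"
      by (simp add: act_one x)
    ultimately show ?thesis
      using orbit_closure_mono[OF yX] by auto
  qed
  then show ?thesis
    using almost_periodic_iff[OF assms(1,2) x] by blast
qed

text \<open>The orbit closure of \<open>x\<close> contains some \<open>N\<close>-minimal set. Since
  \<open>x\<close> lies in the orbit closure of each of its points, \<open>x\<close> belongs to a
  translate of that set, and by normality the translate is again \<open>N\<close>-minimal.\<close>

lemma almost_periodic_normal_subgroup:
  assumes "compact_space X" "Hausdorff_space X" "N \<lhd> G" "cocompact G \<tau> N"
    and x: "x \<in> topspace X" and ap: "almost_periodic G \<tau> X act x"
  shows "almost_periodic (G\<lparr>carrier := N\<rparr>) (subtopology \<tau> N) X act x"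
proof -
  let ?O = "orbit_closure (G\<lparr>carrier := N\<rparr>) X act" and ?Y = "orbit_closure G X act x"
  have sub: "subgroup N G"
    using assms(3) by (rule normal_imp_subgroup)
  interpret N: flow "G\<lparr>carrier := N\<rparr>" "subtopology \<tau> N" X act
    using sub by (rule flow_subgroup)
  have "compactin X ?Y"
    using assms(1) closedin_orbit_closure by (rule closedin_compact_space)
  moreover have "?Y \<noteq> {}"
    using self_in_orbit_closure[OF x] by auto
  moreover have "act n y \<in> ?Y" if "n \<in> carrier (G\<lparr>carrier := N\<rparr>)" "y \<in> ?Y" for n y
    using that subgroup.subset[OF sub] by (auto intro: orbit_closure_invariant[OF x])
  ultimately obtain z where z: "z \<in> ?Y" and min: "\<And>y. y \<in> ?O z \<Longrightarrow> z \<in> ?O y"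
    using N.exists_minimal_subset[of ?Y] closedin_orbit_closure by metis
  have zX: "z \<in> topspace X"
    using z orbit_closure_subset_topspace by auto
  have "x \<in> orbit_closure G X act z"
    using ap z almost_periodic_iff[OF assms(1,2) x] by blast
  then obtain t m where t: "t \<in> carrier G" and m: "m \<in> ?O z" and xtm: "x = act t m"
    using orbit_closure_eq_translates[OF sub assms(4) zX] by auto
  have mX: "m \<in> topspace X"
    using m N.orbit_closure_subset_topspace by auto
  have "x \<in> ?O y" if y_in: "y \<in> ?O x" for y
  proof -
    obtain m' where m': "m' \<in> ?O m" and y: "y = act t m'"
      using y_in unfolding xtm image_orbit_closure[OF assms(3) t mX, symmetric] by auto
    have m'z: "m' \<in> ?O z"
      using m' N.orbit_closure_mono[OF zX m] by auto
    then have m'X: "m' \<in> topspace X"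
      using N.orbit_closure_subset_topspace by auto
    \<comment> \<open>Minimality brings \<open>z\<close> back into the \<open>N\<close>-orbit
      closure of \<open>m'\<close>, and with \<open>z\<close> its whole \<open>N\<close>-orbit
      closure, which contains \<open>m\<close>.\<close>
    have "m \<in> ?O m'"
      using m N.orbit_closure_mono[OF m'X min[OF m'z]] by auto
    then show ?thesis
      using image_orbit_closure[OF assms(3) t m'X] by (auto simp: xtm y)
  qed
  then show ?thesis
    using N.almost_periodic_iff[OF assms(1,2) x] by blast
qed

lemma almost_periodic_subnormal_subgroup:
  assumes "compact_space X" "Hausdorff_space X"
    and H: "H \<in> sncc_subgroups G \<tau>"
    and x: "x \<in> topspace X" and ap: "almost_periodic G \<tau> X act x"
  shows "almost_periodic (G\<lparr>carrier := H\<rparr>) (subtopology \<tau> H) X act x"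
proof -
  have sub: "subgroup H G" and coc: "cocompact G \<tau> H" and closed: "closedin \<tau> H"
    using H by (auto simp: sncc_subgroups_def)
  obtain n K where K0: "K 0 = H" and Kn: "K n = carrier G"
    and subK: "\<And>i. i \<le> n \<Longrightarrow> subgroup (K i) G"
    and normK: "\<And>i. i < n \<Longrightarrow> K i \<lhd> G\<lparr>carrier := K (Suc i)\<rparr>"
    using H unfolding sncc_subgroups_def subnormal_def by blast
  have mono: "K i \<subseteq> K (Suc i)" if "i < n" for i
    using subgroup.subset[OF normal_imp_subgroup[OF normK[OF that]]] by simp
  have HK: "H \<subseteq> K i" if "i \<le> n" for i
    using that
  proof (induction i)
    case (Suc i)
    then show ?case
      using mono[of i] by auto
  qed (simp add: K0)
  \<comment> \<open>The groups \<open>K i\<close> need not be closed, but passing \<open>cocompact G \<tau> H\<close> on to them requires it.\<close>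
  define L where "L i = \<tau> closure_of (K i)" for i
  have "0 \<le> n"
    by simp
  \<comment> \<open>The induction descends from \<open>n\<close> to \<open>0\<close>. Each step
    applies the normal case inside \<open>L (Suc i)\<close>, where \<open>L i\<close> is co-compact
    because it contains \<open>H\<close>.\<close>
  then have "almost_periodic (G\<lparr>carrier := L 0\<rparr>) (subtopology \<tau> (L 0)) X act x"
  proof (induction rule: inc_induct)
    case base
    have "L n = carrier G"
      using closure_of_topspace[of \<tau>] by (simp only: L_def Kn topspace_eq_carrier)
    moreover have "subtopology \<tau> (carrier G) = \<tau>"
      using subtopology_topspace[of \<tau>] by (simp only: topspace_eq_carrier)
    ultimately show ?case
      using ap by simp
  next
    case (step i)
    interpret L: flow "G\<lparr>carrier := L (Suc i)\<rparr>" "subtopology \<tau> (L (Suc i))" X act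
      using subK step.hyps by (intro flow_subgroup) (simp add: L_def subgroup_closure_of)
    have sub': "L i \<subseteq> L (Suc i)"
      using mono step.hyps by (simp add: L_def closure_of_mono)
    have "L i \<lhd> G\<lparr>carrier := L (Suc i)\<rparr>"
      unfolding L_def using subK normK step.hyps by (intro normal_closure_of) auto
    moreover have "cocompact (G\<lparr>carrier := L (Suc i)\<rparr>) (subtopology \<tau> (L (Suc i))) (L i)"
    proof (rule cocompact_intermediate[OF sub _ _ _ sub' _ coc])
      show "subgroup (L i) G" "subgroup (L (Suc i)) G"
        using subK step.hyps by (auto simp: L_def subgroup_closure_of)
      show "H \<subseteq> L i"
        using HK[of i] subset_closure_of_subgroup[OF subK[of i]] step.hyps by (auto simp: L_def)
      show "closedin \<tau> (L (Suc i))"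
        by (simp add: L_def)
    qed
    ultimately have "almost_periodic (G\<lparr>carrier := L (Suc i), carrier := L i\<rparr>)
        (subtopology (subtopology \<tau> (L (Suc i))) (L i)) X act x"
      using assms(1,2) x step.IH by (intro L.almost_periodic_normal_subgroup)
    moreover have "L (Suc i) \<inter> L i = L i"
      using sub' by auto
    ultimately show ?case
      by (simp add: subtopology_subtopology)
  qed
  \<comment> \<open>Closedness of \<open>H\<close> ensures that the chain of closures still ends at
    \<open>H\<close> itself.\<close>
  moreover have "L 0 = H"
    using closed by (simp add: L_def K0 closure_of_closedin)
  ultimately show ?thesis
    by simp
qed

section \<open>Normal co-compact subgroups and minimal flows\<close>

text \<open>The diagonal action makes \<open>closedin_translates\<close> available for relations on
  \<open>X\<close>.\<close>

lemma flow_prod: "flow G \<tau> (prod_topology X X) (\<lambda>t p. (act t (fst p), act t (snd p)))"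
proof -
  have cont: "continuous_map (prod_topology \<tau> (prod_topology X X)) X (\<lambda>q. act (fst q) (p (snd q)))"
    if "continuous_map (prod_topology X X) X p" for p
  proof -
    have "continuous_map (prod_topology \<tau> (prod_topology X X)) (prod_topology \<tau> X)
        (\<lambda>q. (fst q, p (snd q)))"
      using continuous_map_compose[OF continuous_map_snd that]
      by (simp add: continuous_map_paired o_def continuous_map_fst)
    from continuous_map_compose[OF this continuous_act] show ?thesis
      by (simp add: o_def)
  qed
  then show ?thesis
    using cont[OF continuous_map_fst] cont[OF continuous_map_snd] act_one act_mult
    by unfold_locales (auto simp: continuous_map_paired case_prod_unfold)
qed

context
  fixes N
  assumes compact: "compact_space X" and Hausdorff: "Hausdorff_space X"
    and minimal: "minimal_flow G X act" and N: "N \<in> ncc_subgroups G \<tau>"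
begin

abbreviation (input) N_orbit_closure where
  "N_orbit_closure \<equiv> orbit_closure (G\<lparr>carrier := N\<rparr>) X act"

lemma normal_N: "N \<lhd> G" and cocompact_N: "cocompact G \<tau> N" and subgroup_N: "subgroup N G"
  using N by (auto simp: ncc_subgroups_def normal_imp_subgroup)

lemma N_orbit_closure_self:
  assumes "x \<in> topspace X"
  shows "x \<in> N_orbit_closure x" and "N_orbit_closure x \<subseteq> topspace X"
    and "closedin X (N_orbit_closure x)"
proof -
  interpret N: flow "G\<lparr>carrier := N\<rparr>" "subtopology \<tau> N" X act
    using subgroup_N by (rule flow_subgroup)
  show "x \<in> N_orbit_closure x" "N_orbit_closure x \<subseteq> topspace X" "closedin X (N_orbit_closure x)"
    using assms by (auto intro: N.self_in_orbit_closure N.closedin_orbit_closure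
        subsetD[OF N.orbit_closure_subset_topspace])
qed

text \<open>In a minimal flow every point is almost periodic for the whole group, hence for
  \<open>N\<close>, so every \<open>N\<close>-orbit closure is \<open>N\<close>-minimal.\<close>

lemma N_orbit_closure_eq:
  assumes x: "x \<in> topspace X" and y: "y \<in> N_orbit_closure x"
  shows "N_orbit_closure y = N_orbit_closure x"
proof -
  interpret N: flow "G\<lparr>carrier := N\<rparr>" "subtopology \<tau> N" X act
    using subgroup_N by (rule flow_subgroup)
  have yX: "y \<in> topspace X"
    using y N.orbit_closure_subset_topspace by auto
  have "\<forall>y\<in>orbit_closure G X act x. x \<in> orbit_closure G X act y"
    using minimal x by (auto simp: minimal_flow_def)
  then have "almost_periodic G \<tau> X act x"
    using almost_periodic_iff[OF compact Hausdorff x] by simp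
  then have "almost_periodic (G\<lparr>carrier := N\<rparr>) (subtopology \<tau> N) X act x"
    using almost_periodic_normal_subgroup[OF compact Hausdorff normal_N cocompact_N x] by simp
  then have "x \<in> N_orbit_closure y"
    using y N.almost_periodic_iff[OF compact Hausdorff x] by simp
  then show ?thesis
    using N.orbit_closure_mono[OF x y] N.orbit_closure_mono[OF yX] by blast
qed

lemma partition_on_N_orbit_closures: "partition_on (topspace X) (N_orbit_closure ` topspace X)"
proof (rule partition_onI)
  show "\<Union>(N_orbit_closure ` topspace X) = topspace X"
    using N_orbit_closure_self by blast
  show "{} \<notin> N_orbit_closure ` topspace X"
    using N_orbit_closure_self(1) by fastforce
  \<comment> \<open>Two orbit closures with a common point both equal the orbit closure of that
    point.\<close>
  show "disjnt p q"
    if "p \<in> N_orbit_closure ` topspace X" "q \<in> N_orbit_closure ` topspace X" "p \<noteq> q" for p q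
    using that N_orbit_closure_eq unfolding disjnt_def by blast
qed

lemma image_N_orbit_closures:
  assumes t: "t \<in> carrier G"
  shows "(\<lambda>C. act t ` C) ` N_orbit_closure ` topspace X = N_orbit_closure ` topspace X"
proof -
  have "act t ` topspace X = topspace X"
  proof (intro equalityI subsetI)
    fix y assume y: "y \<in> topspace X"
    then have "y = act t (act (inv t) y)" "act (inv t) y \<in> topspace X"
      using t by (simp_all add: act_act_inv act_closed)
    then show "y \<in> act t ` topspace X"
      by (rule image_eqI)
  qed (use t act_closed in auto)
  moreover have "(\<lambda>C. act t ` C) ` N_orbit_closure ` topspace X =
      N_orbit_closure ` act t ` topspace X"
    by (simp add: image_image image_orbit_closure[OF normal_N t])
  ultimately show ?thesis
    by simp
qed

\<comment> \<open>The relation is the union of the translates \<open>tM \<times> tM\<close> of a single minimal set \<open>M\<close> of \<open>N\<close>, so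
  co-compactness of \<open>N\<close> applies to the diagonal flow on \<open>X \<times> X\<close>.\<close>
lemma closedin_N_orbit_closure_relation:
  "closedin (prod_topology X X) {p. fst p \<in> topspace X \<and> snd p \<in> N_orbit_closure (fst p)}"
proof (cases "topspace X = {}")
  case True
  then show ?thesis
    by simp
next
  case False
  then obtain x where x: "x \<in> topspace X"
    by blast
  interpret N: flow "G\<lparr>carrier := N\<rparr>" "subtopology \<tau> N" X act
    using subgroup_N by (rule flow_subgroup)
  interpret XX: flow G \<tau> "prod_topology X X" "\<lambda>t p. (act t (fst p), act t (snd p))"
    by (rule flow_prod)
  let ?M = "N_orbit_closure x"
  let ?R = "{p. fst p \<in> topspace X \<and> snd p \<in> N_orbit_closure (fst p)}"
  have "closedin (prod_topology X X)
      (\<Union>t\<in>carrier G. (\<lambda>p. (act t (fst p), act t (snd p))) ` (?M \<times> ?M))"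
  proof (rule XX.closedin_translates[OF subgroup_N cocompact_N])
    show "closedin (prod_topology X X) (?M \<times> ?M)"
      using N_orbit_closure_self(3)[OF x] by (simp add: closedin_prod_Times_iff)
    show "(act h (fst m), act h (snd m)) \<in> ?M \<times> ?M" if "h \<in> N" "m \<in> ?M \<times> ?M" for h m
      using that N.orbit_closure_invariant[OF x] by auto
  qed
  also have "(\<Union>t\<in>carrier G. (\<lambda>p. (act t (fst p), act t (snd p))) ` (?M \<times> ?M)) = ?R"
  proof (intro equalityI subsetI)
    fix p assume "p \<in> (\<Union>t\<in>carrier G. (\<lambda>p. (act t (fst p), act t (snd p))) ` (?M \<times> ?M))"
    then obtain t m m' where t: "t \<in> carrier G" and m: "m \<in> ?M" "m' \<in> ?M"
        and p: "p = (act t m, act t m')"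
      by auto
    have mX: "m \<in> topspace X"
      using m N.orbit_closure_subset_topspace by auto
    have "m' \<in> N_orbit_closure m"
      using m N_orbit_closure_eq[OF x] by simp
    then show "p \<in> ?R"
      using image_orbit_closure[OF normal_N t mX] t mX by (auto simp: p act_closed)
  next
    \<comment> \<open>By minimality the translates of \<open>?M\<close> cover \<open>X\<close>, so
      the first coordinate is some \<open>act t m\<close>; normality then places the second
      coordinate in the same translate.\<close>
    fix p assume p: "p \<in> ?R"
    then have "fst p \<in> orbit_closure G X act x"
      using minimal x by (simp add: minimal_flow_def)
    then obtain t m where t: "t \<in> carrier G" and m: "m \<in> ?M" and a: "fst p = act t m"
      using orbit_closure_eq_translates[OF subgroup_N cocompact_N x] by auto
    have mX: "m \<in> topspace X"
      using m N.orbit_closure_subset_topspace by auto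
    have "snd p \<in> act t ` N_orbit_closure m"
      using p image_orbit_closure[OF normal_N t mX] by (simp add: a)
    then obtain m' where "m' \<in> ?M" "snd p = act t m'"
      using N_orbit_closure_eq[OF x m] by auto
    then show "p \<in> (\<Union>t\<in>carrier G. (\<lambda>p. (act t (fst p), act t (snd p))) ` (?M \<times> ?M))"
      using t m a by (intro UN_I[of t] image_eqI[of _ _ "(m, m')"]) (auto simp: prod_eq_iff)
  qed
  finally show ?thesis .
qed

section \<open>Continuity into the Vietoris hyperspace\<close>

lemma continuous_map_N_orbit_closure: "continuous_map X (vietoris X) N_orbit_closure"
proof -
  let ?R = "{p. fst p \<in> topspace X \<and> snd p \<in> N_orbit_closure (fst p)}"
  have comp: "compactin X (N_orbit_closure x)" "N_orbit_closure x \<noteq> {}" if "x \<in> topspace X" for x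
    using N_orbit_closure_self(1)[OF that]
      closedin_compact_space[OF compact N_orbit_closure_self(3)[OF that]]
    by auto
  \<comment> \<open>Upper semicontinuity: the points whose orbit closure leaves \<open>U\<close>
    form the first projection of a closed part of the relation, and projection along the compact
    factor \<open>X\<close> is a closed map.\<close>
  have upper: "openin X {x \<in> topspace X. N_orbit_closure x \<subseteq> U}" if "openin X U" for U
  proof -
    have "closedin (prod_topology X X) (?R \<inter> topspace X \<times> (topspace X - U))"
      using that closedin_N_orbit_closure_relation
      by (intro closedin_Int) (auto simp: closedin_prod_Times_iff)
    then have "closedin X (fst ` (?R \<inter> topspace X \<times> (topspace X - U)))"
      using closed_map_fst[OF compact] by (auto simp: closed_map_def)
    moreover have "{x \<in> topspace X. N_orbit_closure x \<subseteq> U} =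
        topspace X - fst ` (?R \<inter> topspace X \<times> (topspace X - U))"
      using N_orbit_closure_self(2) by force
    ultimately show ?thesis
      by (simp only: openin_diff openin_topspace)
  qed
  \<comment> \<open>Lower semicontinuity: an open set meets the closure of an orbit exactly when it
    meets the orbit, so the set is a union of preimages of \<open>U\<close> under single elements of
    \<open>N\<close>.\<close>
  have lower: "openin X {x \<in> topspace X. N_orbit_closure x \<inter> U \<noteq> {}}" if "openin X U" for U
  proof -
    have "{x \<in> topspace X. N_orbit_closure x \<inter> U \<noteq> {}} =
        (\<Union>n\<in>N. {x \<in> topspace X. act n x \<in> U})"
      using openin_Int_closure_of_eq_empty[OF that] by (auto simp: orbit_closure_def Int_commute)
    moreover have "openin X {x \<in> topspace X. act n x \<in> U}" if "n \<in> N" for n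
      using that \<open>openin X U\<close> subgroup.subset[OF subgroup_N]
      by (intro openin_continuous_map_preimage[OF continuous_map_act]) auto
    ultimately show ?thesis
      by auto
  qed
  show ?thesis
    unfolding vietoris_def
  proof (rule continuous_on_generated_topo)
    fix \<U> assume "\<U> \<in> (\<lambda>U. {K. compactin X K \<and> K \<noteq> {} \<and> K \<subseteq> U}) ` {U. openin X U} \<union>
        (\<lambda>U. {K. compactin X K \<and> K \<noteq> {} \<and> K \<inter> U \<noteq> {}}) ` {U. openin X U}"
    then obtain U where U: "openin X U" and "\<U> = {K. compactin X K \<and> K \<noteq> {} \<and> K \<subseteq> U} \<or>
        \<U> = {K. compactin X K \<and> K \<noteq> {} \<and> K \<inter> U \<noteq> {}}"
      by auto
    then have "N_orbit_closure -` \<U> \<inter> topspace X = {x \<in> topspace X. N_orbit_closure x \<subseteq> U} \<or>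
        N_orbit_closure -` \<U> \<inter> topspace X = {x \<in> topspace X. N_orbit_closure x \<inter> U \<noteq> {}}"
      using comp by auto
    then show "openin X (N_orbit_closure -` \<U> \<inter> topspace X)"
      using upper[OF U] lower[OF U] by auto
  next
    have "N_orbit_closure ` topspace X \<subseteq> topspace (vietoris X)"
      using comp by (auto simp: topspace_vietoris)
    then show "N_orbit_closure ` topspace X \<subseteq>
        \<Union>((\<lambda>U. {K. compactin X K \<and> K \<noteq> {} \<and> K \<subseteq> U}) ` {U. openin X U} \<union>
        (\<lambda>U. {K. compactin X K \<and> K \<noteq> {} \<and> K \<inter> U \<noteq> {}}) ` {U. openin X U})"
      by (simp only: vietoris_def topology_generated_by_topspace)
  qed
qed

end

end

theorem theorem3p1:
  fixes T :: "('a, 'm) monoid_scheme" and \<tau> :: "'a topology"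
    and X :: "'x topology" and act :: "'a \<Rightarrow> 'x \<Rightarrow> 'x" and H :: "'a set"
  assumes "flow T \<tau> X act"
    and "Hausdorff_space \<tau>"
    and "compact_space X" and "Hausdorff_space X"
    and "subgroup H T" and "closedin \<tau> H"
  shows
    "(H \<in> sncc_subgroups T \<tau> \<longrightarrow>
        (\<forall>x \<in> topspace X. almost_periodic T \<tau> X act x \<longrightarrow>
           almost_periodic (T\<lparr>carrier := H\<rparr>) (subtopology \<tau> H) X act x)) \<and>
     (cocompact T \<tau> H \<longrightarrow>
        (\<forall>x \<in> topspace X. almost_periodic (T\<lparr>carrier := H\<rparr>) (subtopology \<tau> H) X act x \<longrightarrow>
           almost_periodic T \<tau> X act x)) \<and>
     (minimal_flow T X act \<and> H \<in> ncc_subgroups T \<tau> \<longrightarrow>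
        (let \<P> = orbit_closure (T\<lparr>carrier := H\<rparr>) X act ` topspace X in
           partition_on (topspace X) \<P> \<and>
           (\<forall>t \<in> carrier T. (\<lambda>C. act t ` C) ` \<P> = \<P>)) \<and>
        continuous_map X (vietoris X) (orbit_closure (T\<lparr>carrier := H\<rparr>) X act)) \<and>
     (\<forall>H' \<in> sncc_subgroups T \<tau>. \<forall>x \<in> topspace X.
        almost_periodic T \<tau> X act x \<longleftrightarrow>
        almost_periodic (T\<lparr>carrier := H'\<rparr>) (subtopology \<tau> H') X act x)"
proof -
  interpret flow T \<tau> X act
    by (rule assms(1))
  \<comment> \<open>Descent along the subnormal chain gives one direction and co-compactness the
    other. The claim is stated for arbitrary \<open>H'\<close>, so that it yields both the first and
    the last assertion.\<close>
  have sncc: "almost_periodic T \<tau> X act x \<longleftrightarrow>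
      almost_periodic (T\<lparr>carrier := H'\<rparr>) (subtopology \<tau> H') X act x"
    if "H' \<in> sncc_subgroups T \<tau>" "x \<in> topspace X" for H' x
    using that almost_periodic_subnormal_subgroup[OF assms(3,4)]
      almost_periodic_of_cocompact_subgroup[OF assms(3,4)]
    by (auto simp: sncc_subgroups_def)
  show ?thesis
    unfolding Let_def
  proof (intro conjI impI ballI)
    fix x assume "H \<in> sncc_subgroups T \<tau>" "x \<in> topspace X" "almost_periodic T \<tau> X act x"
    then show "almost_periodic (T\<lparr>carrier := H\<rparr>) (subtopology \<tau> H) X act x"
      using sncc by simp
  next
    fix x assume "cocompact T \<tau> H" "x \<in> topspace X"
      "almost_periodic (T\<lparr>carrier := H\<rparr>) (subtopology \<tau> H) X act x"
    then show "almost_periodic T \<tau> X act x"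
      using almost_periodic_of_cocompact_subgroup[OF assms(3,4,5)] by simp
  next
    assume "minimal_flow T X act \<and> H \<in> ncc_subgroups T \<tau>"
    then have ncc: "minimal_flow T X act" "H \<in> ncc_subgroups T \<tau>"
      by auto
    show "partition_on (topspace X) (orbit_closure (T\<lparr>carrier := H\<rparr>) X act ` topspace X)"
      using assms(3,4) ncc by (rule partition_on_N_orbit_closures)
    show "(\<lambda>C. act t ` C) ` orbit_closure (T\<lparr>carrier := H\<rparr>) X act ` topspace X =
        orbit_closure (T\<lparr>carrier := H\<rparr>) X act ` topspace X" if "t \<in> carrier T" for t
      using assms(3,4) ncc that by (rule image_N_orbit_closures)
    show "continuous_map X (vietoris X) (orbit_closure (T\<lparr>carrier := H\<rparr>) X act)"
      using assms(3,4) ncc by (rule continuous_map_N_orbit_closure)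
  next
    fix H' x assume "H' \<in> sncc_subgroups T \<tau>" "x \<in> topspace X"
    then show "almost_periodic T \<tau> X act x \<longleftrightarrow>
        almost_periodic (T\<lparr>carrier := H'\<rparr>) (subtopology \<tau> H') X act x"
      by (rule sncc)
  qed
qed

end
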